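(* Let $(X_1,d_1)$ and $(X_2,d_2)$ be Gromov hyperbolic metric spaces, let $z_i\in X_i$ for $i=1,2$, and let $\Delta\ge 0$. Let $$Y_\Delta:=\{(x_1,x_2)\in X_1\times X_2 \;:\; |d_1(x_1,z_1)-d_2(x_2,z_2)|\le \Delta\}$$ and let $d_m\big((x_1,x_2),(x_1',x_2')\big):=\max\{d_1(x_1,x_1'),d_2(x_2,x_2')\}$ on $X_1\times X_2$. Then the metric space $(Y_\Delta, d_m|_{Y_\Delta\times Y_\Delta})$ is Gromov hyperbolic.
   Context: A metric space $(X,d)$ is called $\delta$-hyperbolic ($\delta\ge 0$) if for all $x,y,z,w\in X$ $$d(x,y)+d(z,w)\le \max\{d(x,z)+d(y,w),\,d(x,w)+d(y,z)\}+2\delta.$$ It is Gromov hyperbolic if it is $\delta$-hyperbolic for some $\delta\ge 0$. *)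

theory Defs
  imports "HOL-Analysis.Abstract_Metric_Spaces"
begin

definition delta_hyperbolic :: "real \<Rightarrow> 'a set \<Rightarrow> ('a \<Rightarrow> 'a \<Rightarrow> real) \<Rightarrow> bool" where
  "delta_hyperbolic \<delta> X d \<longleftrightarrow> Metric_space X d \<and> \<delta> \<ge> 0 \<and>
     (\<forall>x\<in>X. \<forall>y\<in>X. \<forall>z\<in>X. \<forall>w\<in>X.
        d x y + d z w \<le> max (d x z + d y w) (d x w + d y z) + 2 * \<delta>)"

definition Gromov_hyperbolic :: "'a set \<Rightarrow> ('a \<Rightarrow> 'a \<Rightarrow> real) \<Rightarrow> bool" where
  "Gromov_hyperbolic X d \<longleftrightarrow> (\<exists>\<delta>. delta_hyperbolic \<delta> X d)"

definition max_dist ::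
  "('a \<Rightarrow> 'a \<Rightarrow> real) \<Rightarrow> ('b \<Rightarrow> 'b \<Rightarrow> real) \<Rightarrow> 'a \<times> 'b \<Rightarrow> 'a \<times> 'b \<Rightarrow> real" where
  "max_dist d1 d2 p q = max (d1 (fst p) (fst q)) (d2 (snd p) (snd q))"

definition near_diagonal ::
  "'a set \<Rightarrow> ('a \<Rightarrow> 'a \<Rightarrow> real) \<Rightarrow> 'a \<Rightarrow> 'b set \<Rightarrow> ('b \<Rightarrow> 'b \<Rightarrow> real) \<Rightarrow> 'b \<Rightarrow> real \<Rightarrow> ('a \<times> 'b) set" where
  "near_diagonal X1 d1 z1 X2 d2 z2 \<Delta> =
     {(x1, x2) \<in> X1 \<times> X2. \<bar>d1 x1 z1 - d2 x2 z2\<bar> \<le> \<Delta>}"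

end

(* Hyperbolicity is the approximate ultrametric inequality for the Gromov products based at a point z;
   this form (with distances to z written as h) involves only h and d.  On the near-diagonal set the
   distances to z1 and to z2 agree up to \<Delta>, so the single weight h(x) = d1(x1, z1) serves both factors,
   and the inequality passes to the maximum of d1 and d2 because it is monotone in d. *)
theory Submission
  imports Defs
begin

lemma Metric_space_subset_max_dist:
  assumes "Metric_space X1 d1" and "Metric_space X2 d2" and sub: "Y \<subseteq> X1 \<times> X2"
  shows "Metric_space Y (max_dist d1 d2)"
proof -
  interpret M1: Metric_space X1 d1 by fact
  interpret M2: Metric_space X2 d2 by fact
  show ?thesis
  proof
    show "0 \<le> max_dist d1 d2 p q" for p q
      by (simp add: max_dist_def le_max_iff_disj)
    show "max_dist d1 d2 p q = max_dist d1 d2 q p" for p q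
      by (simp add: max_dist_def M1.commute M2.commute)
    show "max_dist d1 d2 p q = 0 \<longleftrightarrow> p = q" if "p \<in> Y" "q \<in> Y" for p q
    proof -
      have mem: "fst p \<in> X1" "fst q \<in> X1" "snd p \<in> X2" "snd q \<in> X2"
        using that sub by auto
      have "max_dist d1 d2 p q = 0 \<longleftrightarrow> d1 (fst p) (fst q) = 0 \<and> d2 (snd p) (snd q) = 0"
        using M1.nonneg[of "fst p" "fst q"] M2.nonneg[of "snd p" "snd q"]
        by (auto simp: max_dist_def max_def intro: antisym)
      then show ?thesis
        using mem by (simp add: prod_eq_iff)
    qed
    show "max_dist d1 d2 p r \<le> max_dist d1 d2 p q + max_dist d1 d2 q r"
      if "p \<in> Y" "q \<in> Y" "r \<in> Y" for p q r
    proof -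
      have mem: "fst p \<in> X1" "fst q \<in> X1" "fst r \<in> X1" "snd p \<in> X2" "snd q \<in> X2" "snd r \<in> X2"
        using that sub by auto
      show ?thesis
        using M1.triangle[OF mem(1-3)] M2.triangle[OF mem(4-6)] unfolding max_dist_def by linarith
    qed
  qed
qed

text \<open>Two weighted inequalities, one bounding \<open>d x y\<close> and one bounding
  \<open>d z w\<close>, are added: the values of \<open>h\<close> cancel, so \<open>h\<close> may be
  any function and need not be a distance in \<open>X\<close>. Each costs \<open>C\<close>, which
  gives the \<open>2 * C\<close> in the definition for \<open>\<delta> = C\<close>.\<close>

lemma delta_hyperbolicI_weight:
  assumes "Metric_space X d" and "C \<ge> 0"
    and weight: "\<And>x y w. x \<in> X \<Longrightarrow> y \<in> X \<Longrightarrow> w \<in> X \<Longrightarrow>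
                  d x y + h w \<le> max (d x w + h y) (d y w + h x) + C"
  shows "delta_hyperbolic C X d"
  unfolding delta_hyperbolic_def
proof (intro conjI ballI assms(1,2))
  interpret Metric_space X d by fact
  fix x y z w assume mem: "x \<in> X" "y \<in> X" "z \<in> X" "w \<in> X"
  note sym = commute[of z x] commute[of z y] commute[of w x] commute[of w y]
  (* If the product (xz) is the largest of the four cross products (xz), (xw), (yz), (yw), then, up to C,
     (xy) \<ge> min (xz) (yz) = (yz) and (zw) \<ge> min (xz) (xw) = (xw); the other cases are symmetric. *)
  show "d x y + d z w \<le> max (d x z + d y w) (d x w + d y z) + 2 * C"
    using weight[OF mem(1,2,3)] weight[OF mem(1,2,4)] weight[OF mem(3,4,1)] weight[OF mem(3,4,2)] sym
    by linarith
qed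

text \<open>The four-point condition with \<open>z\<close> as fourth point is the weighted
  inequality for the weight \<open>d _ z\<close>, with constant \<open>2 * \<delta>\<close>.\<close>

lemma delta_hyperbolic_weight:
  assumes "delta_hyperbolic \<delta> X d" and mem: "z \<in> X" "x \<in> X" "y \<in> X" "w \<in> X"
  shows "d x y + d w z \<le> max (d x w + d y z) (d y w + d x z) + 2 * \<delta>"
proof -
  have "d x y + d w z \<le> max (d x w + d y z) (d x z + d y w) + 2 * \<delta>"
    using assms unfolding delta_hyperbolic_def by blast
  then show ?thesis by (simp add: add.commute)
qed

theorem theorem1:
  fixes X1 :: "'a set" and d1 :: "'a \<Rightarrow> 'a \<Rightarrow> real" and z1 :: 'a
    and X2 :: "'b set" and d2 :: "'b \<Rightarrow> 'b \<Rightarrow> real" and z2 :: 'b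
    and \<Delta> :: real
  assumes "Gromov_hyperbolic X1 d1" and "Gromov_hyperbolic X2 d2"
    and "z1 \<in> X1" and "z2 \<in> X2" and "\<Delta> \<ge> 0"
  shows "Gromov_hyperbolic (near_diagonal X1 d1 z1 X2 d2 z2 \<Delta>) (max_dist d1 d2)"
proof -
  let ?Y = "near_diagonal X1 d1 z1 X2 d2 z2 \<Delta>"
  obtain \<delta>1 \<delta>2 where hyp: "delta_hyperbolic \<delta>1 X1 d1" "delta_hyperbolic \<delta>2 X2 d2"
    using assms(1,2) unfolding Gromov_hyperbolic_def by blast
  then have M: "Metric_space X1 d1" "Metric_space X2 d2" and nonneg: "\<delta>1 \<ge> 0" "\<delta>2 \<ge> 0"
    unfolding delta_hyperbolic_def by auto
  \<comment> \<open>A sum rather than a maximum, so that one constant covers the errors of both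
    factors.\<close>
  define C where "C = 2 * \<delta>1 + 2 * \<delta>2 + 2 * \<Delta>"
  have "delta_hyperbolic C ?Y (max_dist d1 d2)"
  proof (rule delta_hyperbolicI_weight[where h = "\<lambda>p. d1 (fst p) z1"])
    show "Metric_space ?Y (max_dist d1 d2)"
      by (rule Metric_space_subset_max_dist[OF M]) (auto simp: near_diagonal_def)
    show "C \<ge> 0"
      using nonneg assms(5) by (simp add: C_def)
    fix p q r assume "p \<in> ?Y" "q \<in> ?Y" "r \<in> ?Y"
    then have mem: "fst p \<in> X1" "fst q \<in> X1" "fst r \<in> X1" "snd p \<in> X2" "snd q \<in> X2" "snd r \<in> X2"
      and near: "\<bar>d1 (fst p) z1 - d2 (snd p) z2\<bar> \<le> \<Delta>" "\<bar>d1 (fst q) z1 - d2 (snd q) z2\<bar> \<le> \<Delta>"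
        "\<bar>d1 (fst r) z1 - d2 (snd r) z2\<bar> \<le> \<Delta>"
      by (auto simp: near_diagonal_def)
    \<comment> \<open>\<open>?B\<close> dominates the corresponding maximum for \<open>d1\<close>,
      and up to \<open>\<Delta>\<close> the one for \<open>d2\<close>, so the two coordinates of
      \<open>p\<close> and \<open>q\<close> on the left can be bounded separately.\<close>
    let ?B = "max (max_dist d1 d2 p r + d1 (fst q) z1) (max_dist d1 d2 q r + d1 (fst p) z1)"
    have "d1 (fst p) (fst q) + d1 (fst r) z1 \<le> ?B + C"
      using delta_hyperbolic_weight[OF hyp(1) assms(3) mem(1-3)] nonneg assms(5)
      unfolding max_dist_def C_def by linarith
    \<comment> \<open>Distances to \<open>z2\<close> are exchanged for the weight once on each side,
      at a cost of \<open>\<Delta>\<close> each time; this is the \<open>2 * \<Delta>\<close> in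
      \<open>C\<close>.\<close>
    moreover have "d2 (snd p) (snd q) + d1 (fst r) z1 \<le> ?B + C"
      using delta_hyperbolic_weight[OF hyp(2) assms(4) mem(4-6)] near nonneg
      unfolding max_dist_def C_def by linarith
    ultimately show "max_dist d1 d2 p q + d1 (fst r) z1 \<le> ?B + C"
      unfolding max_dist_def[of d1 d2 p q] by linarith
  qed
  then show ?thesis
    unfolding Gromov_hyperbolic_def by blast
qed

end
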